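(* Let $Z=z_1e_1+z_2e_2$, $\mathcal{V}=\nu_1e_1+\nu_2e_2=\alpha_1+j\alpha_2$, $M=\mu_1e_1+\mu_2e_2=\beta_1+j\beta_2$, $C=c_1e_1+c_2e_2\in\mathbb{BC}$ ($\alpha_1,\alpha_2,\beta_1,\beta_2\in\mathbb{C}(i)$) satisfy $\Re(\alpha_1)>|\Im(\alpha_2)|$ and $\Re(\beta_1)>|\Im(\beta_2)|$. Then $$E_{\mathcal{V}+M,C}(Z)=\frac{Z^{\mathcal{V}+M}}{\Gamma(\mathcal{V})\Gamma(M)}\sum_{r=0}^{\infty}\frac{(CZ)^r}{r!}\int_A\int_D s^{\mathcal{V}-1}(1-s)^{M+r}t^{M-1}(1-t)^r\,ds\,dt,$$ where $A=(A_1(s_1),A_2(s_2))$ and $D=(D_1(t_1),D_2(t_2))$ are two curves in $\mathbb{BC}$, with variables $s=s_1e_1+s_2e_2$ and $t=t_1e_1+t_2e_2$, $0\le s_1,s_2,t_1,t_2\le 1$.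
   Context: Bicomplex numbers: $\mathbb{BC}=\{w_1+jw_2: w_1,w_2\in\mathbb{C}(i)\}$, where $\mathbb{C}(i)$ is the complex field with unit $i$, $i^2=j^2=-1$, $ij=ji$. Put $e_1=\frac{1+ij}{2}$, $e_2=\frac{1-ij}{2}$, so $e_1+e_2=1$, $e_l^2=e_l$, $e_1e_2=0$. Every $Z=w_1+jw_2$ is uniquely $Z=z_1e_1+z_2e_2$ with $z_1=w_1-iw_2$, $z_2=w_1+iw_2\in\mathbb{C}(i)$, and addition, multiplication and division are componentwise in $e_1,e_2$; in particular $\nu_1=\alpha_1-i\alpha_2$, $\nu_2=\alpha_1+i\alpha_2$, and similarly for $M$. Functions act componentwise: $\Gamma(Y)=\Gamma(y_1)e_1+\Gamma(y_2)e_2$ for $Y=y_1e_1+y_2e_2$ (with $1/\Gamma$ equal to $0$ at the poles of $\Gamma$), and $Z^{W}=z_1^{w_1}e_1+z_2^{w_2}e_2$ for $Z=z_1e_1+z_2e_2$, $W=w_1e_1+w_2e_2$ (principal complex powers; usual powers with $0^0=1$ for integer exponents). Identities are understood for $Z$ at which the occurring powers are defined (e.g. $z_1z_2\neq0$). Bicomplex Miller-Ross function: $E_{\mathcal{V},C}(Z)=Z^{\mathcal{V}}\sum_{r=0}^{\infty}\frac{(CZ)^r}{\Gamma(\mathcal{V}+r+1)}$ for $\mathcal{V},C,Z\in\mathbb{BC}$. Integration: for a bicomplex curve $D=(D_1,D_2)$ with component curves $D_1,D_2$ in $\mathbb{C}(i)$, $\int_D f(t)\,dt=\left[\int_{D_1}f_1(t_1)dt_1\right]e_1+\left[\int_{D_2}f_2(t_2)dt_2\right]e_2$,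 where $f=f_1e_1+f_2e_2$ componentwise. Here $A_1,A_2,D_1,D_2$ are all the segment $[0,1]$ traversed from $0$ to $1$; $s$ is integrated over $A$ and $t$ over $D$. *)

theory Defs
  imports "HOL-Complex_Analysis.Complex_Analysis"
begin

section \<open>The ring of bicomplex numbers\<close>

text \<open>\<open>BC w1 w2\<close> stands for $w_1 + j w_2$.\<close>

datatype bicomplex = BC (part1: complex) (part2: complex)

lemma bicomplex_eq_iff: "X = Y \<longleftrightarrow> part1 X = part1 Y \<and> part2 X = part2 Y"
  by (cases X; cases Y) auto

instantiation bicomplex :: comm_ring_1
begin

definition "0 = BC 0 0"
definition "1 = BC 1 0"
definition "X + Y = BC (part1 X + part1 Y) (part2 X + part2 Y)"
definition "- X = BC (- part1 X) (- part2 X)"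
definition "X - Y = BC (part1 X - part1 Y) (part2 X - part2 Y)"
definition "X * Y = BC (part1 X * part1 Y - part2 X * part2 Y) (part1 X * part2 Y + part2 X * part1 Y)"

instance
  by standard
    (auto simp: zero_bicomplex_def one_bicomplex_def plus_bicomplex_def uminus_bicomplex_def
      minus_bicomplex_def times_bicomplex_def bicomplex_eq_iff algebra_simps)

end

instantiation bicomplex :: real_algebra_1
begin

definition "scaleR r X = BC (r *\<^sub>R part1 X) (r *\<^sub>R part2 X)"

instance
  by standard
    (auto simp: scaleR_bicomplex_def plus_bicomplex_def times_bicomplex_def bicomplex_eq_iff
      algebra_simps)

end

instantiation bicomplex :: real_normed_vector
begin

definition "norm X = sqrt ((cmod (part1 X))\<^sup>2 + (cmod (part2 X))\<^sup>2)"
definition "sgn X = X /\<^sub>R norm X" for X :: bicomplex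
definition "dist X Y = norm (X - Y)" for X Y :: bicomplex
definition [code del]:
  "(uniformity :: (bicomplex \<times> bicomplex) filter) = (INF e\<in>{0 <..}. principal {(X, Y). dist X Y < e})"
definition [code del]:
  "open (U :: bicomplex set) \<longleftrightarrow> (\<forall>X\<in>U. eventually (\<lambda>(X', Y). X' = X \<longrightarrow> Y \<in> U) uniformity)"

instance
proof
  fix X Y :: bicomplex and r :: real and U :: "bicomplex set"
  show "(norm X = 0) = (X = 0)"
    by (simp add: norm_bicomplex_def zero_bicomplex_def bicomplex_eq_iff add_nonneg_eq_0_iff)
  show "norm (X + Y) \<le> norm X + norm Y"
    using norm_triangle_ineq[of "(part1 X, part2 X)" "(part1 Y, part2 Y)"]
    by (simp add: norm_bicomplex_def plus_bicomplex_def norm_Pair)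
  show "norm (r *\<^sub>R X) = \<bar>r\<bar> * norm X"
    using norm_scaleR[of r "(part1 X, part2 X)"]
    by (simp add: norm_bicomplex_def scaleR_bicomplex_def norm_Pair)
qed (rule sgn_bicomplex_def dist_bicomplex_def uniformity_bicomplex_def open_bicomplex_def)+

end

definition bc_of_complex :: "complex \<Rightarrow> bicomplex" where
  "bc_of_complex w = BC w 0"

definition bc_j :: bicomplex where
  "bc_j = BC 0 1"

lemma bc_j_square: "bc_j * bc_j = -1"
  by (simp add: bc_j_def times_bicomplex_def uminus_bicomplex_def one_bicomplex_def)

lemma BC_eq: "BC w1 w2 = bc_of_complex w1 + bc_j * bc_of_complex w2"
  by (simp add: bc_j_def bc_of_complex_def times_bicomplex_def plus_bicomplex_def)


section \<open>The idempotent representation\<close>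

definition bc_e1 :: bicomplex where
  "bc_e1 = bc_of_complex (1/2) * (1 + bc_of_complex \<i> * bc_j)"

definition bc_e2 :: bicomplex where
  "bc_e2 = bc_of_complex (1/2) * (1 - bc_of_complex \<i> * bc_j)"

definition idem :: "complex \<Rightarrow> complex \<Rightarrow> bicomplex" where
  "idem z1 z2 = bc_of_complex z1 * bc_e1 + bc_of_complex z2 * bc_e2"

definition proj1 :: "bicomplex \<Rightarrow> complex" where
  "proj1 Z = part1 Z - \<i> * part2 Z"

definition proj2 :: "bicomplex \<Rightarrow> complex" where
  "proj2 Z = part1 Z + \<i> * part2 Z"

lemmas bc_basic_defs = bc_e1_def bc_e2_def bc_of_complex_def bc_j_def plus_bicomplex_def
  minus_bicomplex_def times_bicomplex_def one_bicomplex_def zero_bicomplex_def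

lemma proj_idem [simp]: "proj1 (idem z1 z2) = z1" "proj2 (idem z1 z2) = z2"
  by (simp_all add: idem_def proj1_def proj2_def bc_basic_defs field_simps)

lemma idem_proj [simp]: "idem (proj1 Z) (proj2 Z) = Z"
  by (simp add: idem_def proj1_def proj2_def bc_basic_defs bicomplex_eq_iff field_simps)

lemma idem_eqs:
  "idem a b + idem c d = idem (a + c) (b + d)"
  "idem a b * idem c d = idem (a * c) (b * d)"
  by (simp_all add: idem_def bc_basic_defs bicomplex_eq_iff field_simps)

text \<open>Division is componentwise; it inherits \<open>x / 0 = 0\<close> in each component. Since
  \<^const>\<open>Gamma\<close> is \<open>0\<close> at its poles, dividing by \<open>bc_Gamma\<close> below gives
  $1/\Gamma = 0$ at the poles.\<close>

instantiation bicomplex :: inverse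
begin

definition "inverse Z = idem (inverse (proj1 Z)) (inverse (proj2 Z))"
definition "X div Y = idem (proj1 X / proj1 Y) (proj2 X / proj2 Y)"

instance ..

end


section \<open>Gamma function, powers and the Miller-Ross function\<close>

definition bc_Gamma :: "bicomplex \<Rightarrow> bicomplex" where
  "bc_Gamma Y = idem (Gamma (proj1 Y)) (Gamma (proj2 Y))"

text \<open>Principal complex power, except that $0^0 = 1$ (the library has \<open>0 powr 0 = 0\<close>).\<close>

definition cpow :: "complex \<Rightarrow> complex \<Rightarrow> complex" where
  "cpow z w = (if w = 0 then 1 else z powr w)"

definition bc_powr :: "bicomplex \<Rightarrow> bicomplex \<Rightarrow> bicomplex" (infixr "bpowr" 80) where
  "Z bpowr W = idem (cpow (proj1 Z) (proj1 W)) (cpow (proj2 Z) (proj2 W))"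

definition miller_ross :: "bicomplex \<Rightarrow> bicomplex \<Rightarrow> bicomplex \<Rightarrow> bicomplex" where
  "miller_ross V C Z = Z bpowr V * (\<Sum>r. (C * Z) ^ r / bc_Gamma (V + of_nat r + 1))"


section \<open>Integration along bicomplex curves\<close>

text \<open>A bicomplex curve is the pair of its component curves, whose parameters vary
  independently. An integrand has to act componentwise on the points of the curve.\<close>

type_synonym bc_curve = "(real \<Rightarrow> complex) \<times> (real \<Rightarrow> complex)"

definition bc_image :: "bc_curve \<Rightarrow> bicomplex set" where
  "bc_image D = {idem z1 z2 | z1 z2. z1 \<in> path_image (fst D) \<and> z2 \<in> path_image (snd D)}"

definition has_bc_integral ::
    "(bicomplex \<Rightarrow> bicomplex) \<Rightarrow> bicomplex \<Rightarrow> bc_curve \<Rightarrow> bool"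
    (infixr "has'_bc'_integral" 50) where
  "(f has_bc_integral I) D \<longleftrightarrow>
     (\<exists>f1 f2. (\<forall>Z\<in>bc_image D. f Z = idem (f1 (proj1 Z)) (f2 (proj2 Z))) \<and>
        (f1 has_contour_integral proj1 I) (fst D) \<and>
        (f2 has_contour_integral proj2 I) (snd D))"

definition bc_integrable_on :: "(bicomplex \<Rightarrow> bicomplex) \<Rightarrow> bc_curve \<Rightarrow> bool"
    (infixr "bc'_integrable'_on" 50) where
  "f bc_integrable_on D \<longleftrightarrow> (\<exists>I. (f has_bc_integral I) D)"

definition bc_integral :: "bc_curve \<Rightarrow> (bicomplex \<Rightarrow> bicomplex) \<Rightarrow> bicomplex" where
  "bc_integral D f = (THE I. (f has_bc_integral I) D)"

lemma has_bc_integral_unique: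
  assumes "(f has_bc_integral I) D" "(f has_bc_integral J) D"
  shows "I = J"
proof -
  obtain f1 f2 where f: "\<forall>Z\<in>bc_image D. f Z = idem (f1 (proj1 Z)) (f2 (proj2 Z))"
    "(f1 has_contour_integral proj1 I) (fst D)" "(f2 has_contour_integral proj2 I) (snd D)"
    using assms(1) unfolding has_bc_integral_def by blast
  obtain g1 g2 where g: "\<forall>Z\<in>bc_image D. f Z = idem (g1 (proj1 Z)) (g2 (proj2 Z))"
    "(g1 has_contour_integral proj1 J) (fst D)" "(g2 has_contour_integral proj2 J) (snd D)"
    using assms(2) unfolding has_bc_integral_def by blast
  have eq: "f1 z1 = g1 z1 \<and> f2 z2 = g2 z2"
    if "z1 \<in> path_image (fst D)" "z2 \<in> path_image (snd D)" for z1 z2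
  proof -
    have "idem z1 z2 \<in> bc_image D" using that unfolding bc_image_def by blast
    then have "idem (f1 z1) (f2 z2) = idem (g1 z1) (g2 z2)" using f(1) g(1) by fastforce
    then show ?thesis by (metis proj_idem)
  qed
  have ne: "fst D 0 \<in> path_image (fst D)" "snd D 0 \<in> path_image (snd D)"
    by (auto simp: path_image_def)
  have "(f1 has_contour_integral proj1 J) (fst D)"
    by (rule has_contour_integral_eq[OF g(2)]) (use eq ne in auto)
  moreover have "(f2 has_contour_integral proj2 J) (snd D)"
    by (rule has_contour_integral_eq[OF g(3)]) (use eq ne in auto)
  ultimately have "proj1 I = proj1 J" "proj2 I = proj2 J"
    using f(2,3) has_contour_integral_unique by blast+
  then show ?thesis by (metis idem_proj)
qed

end

theory Submission
  imports Defs
begin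

text \<open>In each idempotent component the double integral splits into a product of two Beta integrals,
  $B(\nu, \mu + r + 1)\, B(\mu, r + 1) = \Gamma(\nu)\Gamma(\mu)\, r! / \Gamma(\nu + \mu + r + 1)$,
  so the series on the right is $\Gamma(\mathcal{V})\Gamma(M)$ times the defining series of
  $E_{\mathcal{V}+M,C}$. The Beta integral with complex parameters comes from integrating
  the convolution of two Gamma densities in both orders.\<close>

section \<open>The Beta integral with complex parameters, and convergence of the component
  series\<close>

definition gamma_density :: "complex \<Rightarrow> real \<Rightarrow> complex" where
  "gamma_density z t = indicator {0<..} t *\<^sub>R (of_real t powr (z - 1) / of_real (exp t))"

text \<open>With a real logarithm in the exponent, measurability is evident, and products of
  densities are compared by adding exponents.\<close>

lemma gamma_density_exp:
  "t > 0 \<Longrightarrow> gamma_density z t = exp ((z - 1) * of_real (ln t) - of_real t)"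
  by (simp add: gamma_density_def powr_def Ln_of_real exp_diff exp_of_real)

lemma gamma_density_measurable [measurable]: "gamma_density z \<in> borel_measurable borel"
proof -
  have "gamma_density z =
      (\<lambda>t. indicator {0<..} t *\<^sub>R exp ((z - 1) * of_real (ln t) - of_real t))"
    by (auto simp: fun_eq_iff indicator_def gamma_density_exp) (simp add: gamma_density_def)
  then show ?thesis by simp
qed

text \<open>Euler's integral, moved from the gauge integral to the Lebesgue integral by absolute
  integrability, so that Fubini's theorem applies.\<close>

lemma has_bochner_integral_gamma_density:
  assumes "Re z > 0"
  shows "has_bochner_integral lborel (gamma_density z) (Gamma z)"
proof -
  have "set_integrable lebesgue {0<..} (\<lambda>t. complex_of_real t powr (z - 1) / of_real (exp t))"
    by (rule absolutely_integrable_Gamma_integral'[OF assms])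
  then have "integrable lebesgue (gamma_density z)"
    by (simp add: set_integrable_def gamma_density_def [abs_def])
  then have i: "integrable lborel (gamma_density z)"
    by (simp add: integrable_completion)
  have "((\<lambda>t. if t \<in> {0<..} then complex_of_real t powr (z - 1) / of_real (exp t) else 0)
      has_integral Gamma z) UNIV"
    using Gamma_integral_complex'[OF assms] by (subst has_integral_restrict_UNIV)
  also have "(\<lambda>t. if t \<in> {0<..} then complex_of_real t powr (z - 1) / of_real (exp t) else 0) =
      gamma_density z"
    by (auto simp: gamma_density_def)
  finally have "integral\<^sup>L lborel (gamma_density z) = Gamma z"
    using has_integral_integral_lborel[OF i] has_integral_unique by blast
  with i show ?thesis by (simp add: has_bochner_integral_iff)
qed

definition beta_density :: "complex \<Rightarrow> complex \<Rightarrow> real \<Rightarrow> complex" where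
  "beta_density a b t =
     indicator {0<..<1} t *\<^sub>R (of_real t powr (a - 1) * (1 - of_real t) powr (b - 1))"

lemma beta_density_exp:
  assumes "0 < t" "t < 1"
  shows "beta_density a b t = exp ((a - 1) * of_real (ln t) + (b - 1) * of_real (ln (1 - t)))"
proof -
  have "complex_of_real t \<noteq> 1" using assms by simp
  then show ?thesis
    using assms Ln_of_real[of t] Ln_of_real[of "1 - t"]
    by (simp add: beta_density_def powr_def exp_add)
qed

lemma beta_density_measurable [measurable]: "beta_density a b \<in> borel_measurable borel"
proof -
  have "beta_density a b = (\<lambda>t. indicator {0<..<1} t *\<^sub>R
      exp ((a - 1) * of_real (ln t) + (b - 1) * of_real (ln (1 - t))))"
    by (auto simp: fun_eq_iff indicator_def beta_density_exp) (auto simp: beta_density_def)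
  then show ?thesis by simp
qed

text \<open>For a positive base the modulus of a power depends only on the real part of the
  exponent, so the real Beta integrand with parameters \<open>Re a\<close> and \<open>Re b\<close>
  dominates.\<close>

lemma integrable_beta_density:
  assumes "Re a > 0" "Re b > 0"
  shows "integrable lborel (beta_density a b)"
proof (rule Bochner_Integration.integrable_bound)
  show "integrable lborel
      (\<lambda>t. indicator {0..1} t *\<^sub>R (t powr (Re a - 1) * (1 - t) powr (Re b - 1)))"
    using integrable_Beta[OF assms] by (simp add: set_integrable_def)
  show "AE t in lborel. norm (beta_density a b t) \<le>
      norm (indicator {0..1} t *\<^sub>R (t powr (Re a - 1) * (1 - t) powr (Re b - 1)))"
  proof (rule AE_I2)
    fix t :: real
    have "norm ((1 - complex_of_real t) powr (b - 1)) = (1 - t) powr (Re b - 1)" if "t < 1"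
      using norm_powr_real_powr[of "of_real (1 - t)" "b - 1"] that by simp
    then show "norm (beta_density a b t) \<le>
      norm (indicator {0..1} t *\<^sub>R (t powr (Re a - 1) * (1 - t) powr (Re b - 1)))"
      by (auto simp: beta_density_def indicator_def norm_mult norm_powr_real_powr)
  qed
qed simp

text \<open>Substitute \<open>t = u * x\<close>. The exponentials combine to
  \<open>exp (- u)\<close> independently of \<open>x\<close>, and the powers of \<open>u\<close>
  separate from those of \<open>x\<close> and \<open>1 - x\<close>.\<close>

lemma gamma_density_convolution:
  assumes "u > 0"
  shows "(LINT t|lborel. gamma_density a t * gamma_density b (u - t)) =
    (LINT t|lborel. beta_density a b t) * gamma_density (a + b) u"
proof -
  have "(LINT t|lborel. gamma_density a t * gamma_density b (u - t)) =
      u *\<^sub>R (LINT x|lborel. gamma_density a (0 + u * x) * gamma_density b (u - (0 + u * x)))"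
    using assms by (subst lborel_integral_real_affine[where c = u and t = 0]) auto
  also have "(\<lambda>x. gamma_density a (0 + u * x) * gamma_density b (u - (0 + u * x))) =
      (\<lambda>x. beta_density a b x * (gamma_density (a + b) u / of_real u))"
  proof
    fix x
    show "gamma_density a (0 + u * x) * gamma_density b (u - (0 + u * x)) =
      beta_density a b x * (gamma_density (a + b) u / of_real u)"
    proof (cases "0 < x \<and> x < 1")
      case True
      have pos: "0 < u * x" "0 < u - u * x" using True assms by simp_all
      have u: "u - u * x = u * (1 - x)" by (simp add: algebra_simps)
      have ln: "ln (u * x) = ln u + ln x" "ln (u - u * x) = ln u + ln (1 - x)"
        unfolding u using True assms by (simp_all add: ln_mult)
      \<comment> \<open>The denominator \<open>u\<close> is made an exponential too. It compensates
        for the Jacobian factor \<open>u\<close> of the substitution.\<close>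
      have "complex_of_real u = exp (of_real (ln u))" using assms by (simp add: exp_of_real)
      then have "beta_density a b x * (gamma_density (a + b) u / of_real u) =
          exp ((a - 1) * of_real (ln x) + (b - 1) * of_real (ln (1 - x)) +
            ((a + b - 1) * of_real (ln u) - of_real u - of_real (ln u)))"
        using True assms by (simp add: beta_density_exp gamma_density_exp exp_add exp_diff)
      also have "\<dots> = exp (((a - 1) * of_real (ln (u * x)) - of_real (u * x)) +
          ((b - 1) * of_real (ln (u - u * x)) - of_real (u - u * x)))"
        unfolding ln by (simp add: algebra_simps)
      also have "\<dots> = gamma_density a (0 + u * x) * gamma_density b (u - (0 + u * x))"
        using pos by (simp only: gamma_density_exp exp_add add_0)
      finally show ?thesis ..
    next
      case False
      \<comment> \<open>One of the two Gamma densities is evaluated at a nonpositive point, so both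
        sides vanish.\<close>
      with assms have "u * x \<le> 0 \<or> u - u * x \<le> 0"
        by (auto simp: mult_le_0_iff not_less)
      with False show ?thesis
        by (auto simp: gamma_density_def beta_density_def)
    qed
  qed
  finally show ?thesis using assms by (simp add: scaleR_conv_of_real)
qed

text \<open>\<open>Gamma\<close> takes the value 0 exactly at its poles; staying away from them
  permits cancelling Gamma factors and using the recurrence.\<close>

lemma Re_pos_not_nonpos_Int: "Re z > 0 \<Longrightarrow> z \<notin> \<int>\<^sub>\<le>\<^sub>0"
  by (auto elim!: nonpos_Ints_cases)

text \<open>Integrating \<open>h\<close> over \<open>u\<close> first gives
  \<open>Gamma a * Gamma b\<close> by translation invariance. Integrating over \<open>t\<close>
  first gives the Beta integral times \<open>Gamma (a + b)\<close>, which is nonzero.\<close>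

lemma integral_beta_density:
  assumes a: "Re a > 0" and b: "Re b > 0"
  shows "(LINT t|lborel. beta_density a b t) = Beta a b"
proof -
  note Ga = has_bochner_integral_gamma_density[OF a]
  note Gb = has_bochner_integral_gamma_density[OF b]
  define h where "h = (\<lambda>t u. gamma_density a t * gamma_density b (u - t))"
  have shift: "has_bochner_integral lborel (\<lambda>u. gamma_density b (u - t)) (Gamma b)" for t
    using lborel_has_bochner_integral_real_affine_iff
      [of 1 "gamma_density b" "Gamma b" "-t"] Gb by simp
  \<comment> \<open>In Fubini's criterion the inner integral of the norm is therefore a constant
    multiple of \<open>norm (gamma_density a t)\<close>.\<close>
  have nshift: "(LINT u|lborel. norm (gamma_density b (u - t))) =
      (LINT u|lborel. norm (gamma_density b u))" for t
    using lborel_integral_real_affine[of 1 "\<lambda>u. norm (gamma_density b u)" "-t"] by simp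
  have meas [measurable]: "case_prod h \<in> borel_measurable (lborel \<Otimes>\<^sub>M lborel)"
    unfolding h_def by measurable
  have int: "integrable (lborel \<Otimes>\<^sub>M lborel) (case_prod h)"
  proof (rule lborel_pair.Fubini_integrable)
    have "(\<lambda>t. LINT u|lborel. norm (case_prod h (t, u))) =
        (\<lambda>t. norm (gamma_density a t) * (LINT u|lborel. norm (gamma_density b u)))"
      by (simp add: h_def norm_mult nshift)
    then show "integrable lborel (\<lambda>t. LINT u|lborel. norm (case_prod h (t, u)))"
      using Ga by (auto simp: has_bochner_integral_iff intro!: integrable_mult_left integrable_norm)
    show "AE t in lborel. integrable lborel (\<lambda>u. case_prod h (t, u))"
      using shift by (auto simp: h_def has_bochner_integral_iff)
  qed simp
  have "Gamma a * Gamma b = (LINT t|lborel. LINT u|lborel. h t u)"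
    using Ga shift by (simp add: h_def has_bochner_integral_iff)
  also have "\<dots> = (LINT u|lborel. LINT t|lborel. h t u)"
    using lborel_pair.Fubini_integral[OF int] by simp
  also have "\<dots> = (LINT u|lborel. (LINT t|lborel. beta_density a b t) * gamma_density (a + b) u)"
  proof (intro Bochner_Integration.integral_cong refl)
    fix u :: real
    show "(LINT t|lborel. h t u) = (LINT t|lborel. beta_density a b t) * gamma_density (a + b) u"
    proof (cases "u > 0")
      case True
      then show ?thesis unfolding h_def by (rule gamma_density_convolution)
    next
      case False
      \<comment> \<open>For \<open>u\<close> \<le> 0 the points \<open>t\<close> and
        \<open>u - t\<close> cannot both be positive.\<close>
      then have "h t u = 0" for t by (auto simp: h_def gamma_density_def indicator_def)
      with False show ?thesis by (simp add: gamma_density_def)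
    qed
  qed
  also have "\<dots> = (LINT t|lborel. beta_density a b t) * Gamma (a + b)"
    using has_bochner_integral_gamma_density[of "a + b"] a b
    by (simp add: has_bochner_integral_iff)
  finally have "Gamma a * Gamma b = (LINT t|lborel. beta_density a b t) * Gamma (a + b)" .
  moreover have "Gamma (a + b) \<noteq> 0"
    using a b by (simp add: Gamma_eq_zero_iff Re_pos_not_nonpos_Int)
  ultimately show ?thesis by (simp add: Beta_def field_simps)
qed

lemma has_integral_Beta_complex:
  assumes "Re a > 0" "Re b > 0"
  shows "((\<lambda>t. complex_of_real t powr (a - 1) * (1 - of_real t) powr (b - 1))
    has_integral Beta a b) {0<..<1}"
proof -
  have "(beta_density a b has_integral Beta a b) UNIV"
    using has_integral_integral_lborel[OF integrable_beta_density[OF assms]]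
    by (simp add: integral_beta_density assms)
  also have "beta_density a b = (\<lambda>t. if t \<in> {0<..<1} then
      complex_of_real t powr (a - 1) * (1 - of_real t) powr (b - 1) else 0)"
    by (auto simp: beta_density_def)
  finally show ?thesis by (subst (asm) has_integral_restrict_UNIV)
qed

text \<open>The endpoints form a null set, so \<open>f\<close> need only be known in between; the
  values of \<open>cpow\<close> at base 0 thus never matter. The constant \<open>c\<close> collects
  factors free of the integration variable.\<close>

lemma has_contour_integral_Beta:
  assumes "Re a > 0" "Re b > 0"
    and "\<And>t. 0 < t \<Longrightarrow> t < 1 \<Longrightarrow>
      f (of_real t) = c * (of_real t powr (a - 1) * (1 - of_real t) powr (b - 1))"
  shows "(f has_contour_integral c * Beta a b) (linepath 0 1)"
proof -
  have "((\<lambda>t. f (of_real t)) has_integral c * Beta a b) {0<..<1}"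
    by (rule has_integral_eq[OF _ has_integral_mult_right[OF has_integral_Beta_complex[OF assms(1,2)]]])
      (simp add: assms(3))
  then show ?thesis
    by (simp add: has_contour_integral_linepath_Reals_iff has_integral_Icc_iff_Ioo)
qed

text \<open>By the recurrence of \<open>Gamma\<close>, consecutive terms have ratio
  \<open>x / (a + of_nat r + 1)\<close>, of modulus at most 1/2 once \<open>r\<close> is at least
  \<open>2 * norm x\<close>.\<close>

lemma summable_power_over_Gamma:
  assumes "Re a > 0"
  shows "summable (\<lambda>r. x ^ r / Gamma (a + of_nat r + 1))"
proof (rule summable_ratio_test[where c = "1/2" and N = "nat \<lceil>2 * norm x\<rceil>"])
  fix r assume r: "nat \<lceil>2 * norm x\<rceil> \<le> r"
  have nz: "a + of_nat r + 1 \<noteq> 0"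
    using assms by (auto simp: complex_eq_iff)
  have G: "Gamma (a + of_nat (Suc r) + 1) = (a + of_nat r + 1) * Gamma (a + of_nat r + 1)"
    using Gamma_plus1[of "a + of_nat r + 1"] Re_pos_not_nonpos_Int[of "a + of_nat r + 1"] assms
    by (simp add: ac_simps)
  have "2 * norm x \<le> real r" using r by linarith
  also have "\<dots> \<le> Re (a + of_nat r + 1)" using assms by simp
  also have "\<dots> \<le> norm (a + of_nat r + 1)" by (rule complex_Re_le_cmod)
  finally have "norm (x / (a + of_nat r + 1)) \<le> 1/2"
    using nz by (simp add: norm_divide divide_simps)
  then have "norm (x / (a + of_nat r + 1)) * norm (x ^ r / Gamma (a + of_nat r + 1)) \<le>
      1/2 * norm (x ^ r / Gamma (a + of_nat r + 1))"
    by (rule mult_right_mono) simp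
  then show "norm (x ^ Suc r / Gamma (a + of_nat (Suc r) + 1)) \<le>
      1/2 * norm (x ^ r / Gamma (a + of_nat r + 1))"
    by (simp only: G) (simp add: norm_mult norm_divide)
qed simp

section \<open>Reduction of bicomplex identities, series and integrals to the idempotent
  components\<close>

lemma bicomplex_eqI: "proj1 X = proj1 Y \<Longrightarrow> proj2 X = proj2 Y \<Longrightarrow> X = Y"
  by (metis idem_proj)

lemma proj_arith [simp]:
  "proj1 0 = 0" "proj2 0 = 0" "proj1 1 = 1" "proj2 1 = 1"
  "proj1 (X + Y) = proj1 X + proj1 Y" "proj2 (X + Y) = proj2 X + proj2 Y"
  "proj1 (X - Y) = proj1 X - proj1 Y" "proj2 (X - Y) = proj2 X - proj2 Y"
  "proj1 (X * Y) = proj1 X * proj1 Y" "proj2 (X * Y) = proj2 X * proj2 Y"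
  "proj1 (X / Y) = proj1 X / proj1 Y" "proj2 (X / Y) = proj2 X / proj2 Y"
  by (simp_all add: divide_bicomplex_def)
     (simp_all add: proj1_def proj2_def bc_basic_defs algebra_simps)

lemma proj_of_nat [simp]: "proj1 (of_nat n) = of_nat n" "proj2 (of_nat n) = of_nat n"
  by (induction n) auto

lemma proj_power [simp]: "proj1 (X ^ n) = proj1 X ^ n" "proj2 (X ^ n) = proj2 X ^ n"
  by (induction n) auto

lemma proj_fact [simp]: "proj1 (fact n) = fact n" "proj2 (fact n) = fact n"
  by (metis of_nat_fact proj_of_nat)+

lemma proj_Gamma [simp]:
  "proj1 (bc_Gamma X) = Gamma (proj1 X)" "proj2 (bc_Gamma X) = Gamma (proj2 X)"
  by (simp_all add: bc_Gamma_def)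

lemma proj_bpowr [simp]:
  "proj1 (X bpowr Y) = cpow (proj1 X) (proj1 Y)" "proj2 (X bpowr Y) = cpow (proj2 X) (proj2 Y)"
  by (simp_all add: bc_powr_def)

lemma tendsto_BC:
  assumes "(f \<longlongrightarrow> a) F" "(g \<longlongrightarrow> b) F"
  shows "((\<lambda>x. BC (f x) (g x)) \<longlongrightarrow> BC a b) F"
proof -
  have "((\<lambda>x. sqrt ((dist (f x) a)\<^sup>2 + (dist (g x) b)\<^sup>2)) \<longlongrightarrow> sqrt (0\<^sup>2 + 0\<^sup>2)) F"
    using assms by (intro tendsto_intros) (simp_all flip: tendsto_dist_iff)
  then show ?thesis
    by (subst tendsto_dist_iff)
      (simp add: dist_bicomplex_def norm_bicomplex_def minus_bicomplex_def dist_norm)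
qed

lemma sums_bicomplex:
  assumes "(\<lambda>n. proj1 (f n)) sums proj1 S" "(\<lambda>n. proj2 (f n)) sums proj2 S"
  shows "f sums S"
proof -
  \<comment> \<open>Inverting \<open>proj1\<close> and \<open>proj2\<close> makes the two parts
    linear in the projections, so convergence of the projections carries over to the parts.\<close>
  have BC: "X = BC ((proj1 X + proj2 X) / 2) ((proj2 X - proj1 X) / (2 * \<i>))" for X
    by (simp add: bicomplex_eq_iff proj1_def proj2_def)
  have sum: "proj1 (sum f A) = (\<Sum>n\<in>A. proj1 (f n))" "proj2 (sum f A) = (\<Sum>n\<in>A. proj2 (f n))" for A
    by (induction A rule: infinite_finite_induct; simp)+
  have "(\<lambda>n. sum f {..<n}) \<longlonglongrightarrow> S"
    using assms unfolding sums_def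
    by (subst BC, subst BC[of S], intro tendsto_BC tendsto_intros) (simp_all add: sum)
  then show ?thesis by (simp add: sums_def)
qed

text \<open>The factor \<open>K\<close> is built in because the norm is not submultiplicative:
  multiplication is passed through the limit in each component. One \<open>S\<close> serves both
  \<open>K = 1\<close> and the product of Gamma values.\<close>

lemma sums_bicomplex_power_over_Gamma:
  assumes "Re (proj1 V) > 0" "Re (proj2 V) > 0"
  obtains S where "\<And>K. (\<lambda>r. K * (X ^ r / bc_Gamma (V + of_nat r + 1))) sums (K * S)"
proof
  fix K
  show "(\<lambda>r. K * (X ^ r / bc_Gamma (V + of_nat r + 1))) sums
    (K * idem (\<Sum>r. proj1 X ^ r / Gamma (proj1 V + of_nat r + 1))
      (\<Sum>r. proj2 X ^ r / Gamma (proj2 V + of_nat r + 1)))"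
    by (rule sums_bicomplex; simp only: proj_arith proj_power proj_Gamma proj_of_nat proj_idem)
      (rule sums_mult summable_sums summable_power_over_Gamma assms)+
qed

lemma has_bc_integral_idem:
  assumes "\<And>Z. f Z = idem (f1 (proj1 Z)) (f2 (proj2 Z))"
    and "(f1 has_contour_integral I1) \<gamma>1" "(f2 has_contour_integral I2) \<gamma>2"
  shows "(f has_bc_integral idem I1 I2) (\<gamma>1, \<gamma>2)"
  using assms unfolding has_bc_integral_def by auto

lemma bc_integral_eqI: "(f has_bc_integral I) D \<Longrightarrow> bc_integral D f = I"
  unfolding bc_integral_def using has_bc_integral_unique by blast

section \<open>The double integral in one idempotent component\<close>

lemma cpow_eq_powr: "z \<noteq> 0 \<Longrightarrow> cpow z w = z powr w"
  by (simp add: cpow_def)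

definition miller_ross_kernel :: "complex \<Rightarrow> complex \<Rightarrow> nat \<Rightarrow> complex \<Rightarrow> complex \<Rightarrow> complex" where
  "miller_ross_kernel \<nu> \<mu> r s t =
     cpow s (\<nu> - 1) * cpow (1 - s) (\<mu> + of_nat r) * cpow t (\<mu> - 1) * (1 - t) ^ r"

text \<open>The factors in \<open>s\<close> are constant here, and \<open>(1 - t) ^ r\<close> is a
  Beta factor with parameter \<open>r + 1\<close>. The point \<open>s\<close> is arbitrary, not only
  on the segment.\<close>

lemma miller_ross_kernel_inner:
  assumes "Re \<mu> > 0"
  shows "(miller_ross_kernel \<nu> \<mu> r s has_contour_integral
    cpow s (\<nu> - 1) * cpow (1 - s) (\<mu> + of_nat r) * Beta \<mu> (of_nat r + 1)) (linepath 0 1)"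
proof (rule has_contour_integral_Beta)
  fix t :: real assume t: "0 < t" "t < 1"
  \<comment> \<open>A nonzero base is needed for \<open>r = 0\<close>, since
    \<open>0 powr 0 = 0\<close> while \<open>0 ^ 0 = 1\<close>.\<close>
  then have "1 - complex_of_real t \<noteq> 0" by (simp add: complex_eq_iff)
  with t show "miller_ross_kernel \<nu> \<mu> r s (of_real t) =
      cpow s (\<nu> - 1) * cpow (1 - s) (\<mu> + of_nat r) *
      (of_real t powr (\<mu> - 1) * (1 - of_real t) powr (of_nat r + 1 - 1))"
    by (simp add: miller_ross_kernel_def cpow_eq_powr powr_nat')
qed (use assms in simp_all)

text \<open>The remaining integral is \<open>Beta\<close> \<nu> (\<mu> + r + 1). Its numerator
  factor \<open>Gamma\<close> (\<mu> + r + 1) cancels the denominator of the inner Beta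
  value.\<close>

lemma miller_ross_kernel_outer:
  assumes "Re \<nu> > 0" "Re \<mu> > 0"
  shows "((\<lambda>s. cpow s (\<nu> - 1) * cpow (1 - s) (\<mu> + of_nat r) * Beta \<mu> (of_nat r + 1))
    has_contour_integral Gamma \<nu> * Gamma \<mu> * fact r / Gamma (\<nu> + \<mu> + of_nat r + 1))
    (linepath 0 1)"
proof -
  have nz: "Gamma (\<mu> + of_nat r + 1) \<noteq> 0"
    using assms Re_pos_not_nonpos_Int[of "\<mu> + of_nat r + 1"] by (simp add: Gamma_eq_zero_iff)
  have "((\<lambda>s. cpow s (\<nu> - 1) * cpow (1 - s) (\<mu> + of_nat r) * Beta \<mu> (of_nat r + 1))
    has_contour_integral Beta \<mu> (of_nat r + 1) * Beta \<nu> (\<mu> + of_nat r + 1)) (linepath 0 1)"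
  proof (rule has_contour_integral_Beta)
    fix s :: real assume "0 < s" "s < 1"
    then have "complex_of_real s \<noteq> 0" "1 - complex_of_real s \<noteq> 0" by simp_all
    then show "cpow (of_real s) (\<nu> - 1) * cpow (1 - of_real s) (\<mu> + of_nat r) *
        Beta \<mu> (of_nat r + 1) = Beta \<mu> (of_nat r + 1) *
        (of_real s powr (\<nu> - 1) * (1 - of_real s) powr (\<mu> + of_nat r + 1 - 1))"
      by (simp add: cpow_eq_powr)
  qed (use assms in simp_all)
  also have "Beta \<mu> (of_nat r + 1) * Beta \<nu> (\<mu> + of_nat r + 1) =
      Gamma \<nu> * Gamma \<mu> * fact r / Gamma (\<nu> + \<mu> + of_nat r + 1)"
    using nz by (simp add: Beta_def Gamma_fact add_ac)
  finally show ?thesis .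
qed


theorem theorem3p2:
  fixes Z V M C :: bicomplex
    and \<alpha>1 \<alpha>2 \<beta>1 \<beta>2 :: complex
    and A D :: bc_curve
    and F :: "nat \<Rightarrow> bicomplex \<Rightarrow> bicomplex \<Rightarrow> bicomplex"
  assumes "V = bc_of_complex \<alpha>1 + bc_j * bc_of_complex \<alpha>2"
    and "M = bc_of_complex \<beta>1 + bc_j * bc_of_complex \<beta>2"
    and "Re \<alpha>1 > \<bar>Im \<alpha>2\<bar>"
    and "Re \<beta>1 > \<bar>Im \<beta>2\<bar>"
    and "A = (linepath 0 1, linepath 0 1)"
    and "D = (linepath 0 1, linepath 0 1)"
    and "\<And>r s t. F r s t =
      s bpowr (V - 1) * (1 - s) bpowr (M + of_nat r) * t bpowr (M - 1) * (1 - t) ^ r"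
  shows "(\<forall>r. \<forall>s\<in>bc_image A. (\<lambda>t. F r s t) bc_integrable_on D) \<and>
    (\<forall>r. (\<lambda>s. bc_integral D (\<lambda>t. F r s t)) bc_integrable_on A) \<and>
    summable (\<lambda>r. (C * Z) ^ r / fact r *
      bc_integral A (\<lambda>s. bc_integral D (\<lambda>t. F r s t))) \<and>
    miller_ross (V + M) C Z =
      Z bpowr (V + M) / (bc_Gamma V * bc_Gamma M) *
        (\<Sum>r. (C * Z) ^ r / fact r *
           bc_integral A (\<lambda>s. bc_integral D (\<lambda>t. F r s t)))"
proof -
  \<comment> \<open>The components of \<open>V\<close> have real parts Re \<alpha>1 + Im \<alpha>2
    and Re \<alpha>1 - Im \<alpha>2, so the hypothesis says precisely that both are positive;
    likewise for \<open>M\<close>.\<close>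
  have pos: "Re (proj1 V) > 0" "Re (proj2 V) > 0" "Re (proj1 M) > 0" "Re (proj2 M) > 0"
    using assms(3,4) unfolding assms(1,2) by (auto simp: proj1_def proj2_def simp flip: BC_eq)
  \<comment> \<open>The closed form of the inner integral. It is valid for every \<open>s\<close>,
    so the inner integral and \<open>J r\<close> agree as functions.\<close>
  define J where "J = (\<lambda>r s. idem
    (cpow (proj1 s) (proj1 V - 1) * cpow (1 - proj1 s) (proj1 M + of_nat r) *
      Beta (proj1 M) (of_nat r + 1))
    (cpow (proj2 s) (proj2 V - 1) * cpow (1 - proj2 s) (proj2 M + of_nat r) *
      Beta (proj2 M) (of_nat r + 1)))"
  have F: "F r s t = idem (miller_ross_kernel (proj1 V) (proj1 M) r (proj1 s) (proj1 t))
      (miller_ross_kernel (proj2 V) (proj2 M) r (proj2 s) (proj2 t))" for r s t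
    by (rule bicomplex_eqI) (simp_all add: assms(7) miller_ross_kernel_def)
  have inner: "((\<lambda>t. F r s t) has_bc_integral J r s) D" for r s
    unfolding assms(6) J_def
    by (rule has_bc_integral_idem, rule F) (intro miller_ross_kernel_inner pos)+
  have outer: "(J r has_bc_integral
      bc_Gamma V * bc_Gamma M * fact r / bc_Gamma (V + M + of_nat r + 1)) A" for r
  proof -
    have "(J r has_bc_integral idem
        (Gamma (proj1 V) * Gamma (proj1 M) * fact r / Gamma (proj1 V + proj1 M + of_nat r + 1))
        (Gamma (proj2 V) * Gamma (proj2 M) * fact r / Gamma (proj2 V + proj2 M + of_nat r + 1))) A"
      unfolding assms(5)
      by (rule has_bc_integral_idem, subst J_def, rule refl) (intro miller_ross_kernel_outer pos)+
    moreover have "idem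
        (Gamma (proj1 V) * Gamma (proj1 M) * fact r / Gamma (proj1 V + proj1 M + of_nat r + 1))
        (Gamma (proj2 V) * Gamma (proj2 M) * fact r / Gamma (proj2 V + proj2 M + of_nat r + 1)) =
        bc_Gamma V * bc_Gamma M * fact r / bc_Gamma (V + M + of_nat r + 1)"
      by (rule bicomplex_eqI) simp_all
    ultimately show ?thesis by simp
  qed
  have J: "(\<lambda>s. bc_integral D (\<lambda>t. F r s t)) = J r" for r
    using bc_integral_eqI[OF inner] by blast
  let ?K = "bc_Gamma V * bc_Gamma M"
  \<comment> \<open>Division is componentwise with \<open>x / 0 = 0\<close>, so cancelling
    \<open>?K\<close> requires both components of each factor to be nonzero.\<close>
  have nz: "Gamma (proj1 V) \<noteq> 0" "Gamma (proj2 V) \<noteq> 0" "Gamma (proj1 M) \<noteq> 0" "Gamma (proj2 M) \<noteq> 0"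
    using pos by (simp_all add: Gamma_eq_zero_iff Re_pos_not_nonpos_Int)
  obtain S where S:
    "\<And>K. (\<lambda>r. K * ((C * Z) ^ r / bc_Gamma (V + M + of_nat r + 1))) sums (K * S)"
    using sums_bicomplex_power_over_Gamma[of "V + M" "C * Z"] pos by auto
  \<comment> \<open>The factorial from the double integral cancels \<open>fact r\<close>, leaving
    \<open>?K\<close> times a term of the defining series.\<close>
  have "(C * Z) ^ r / fact r * bc_integral A (\<lambda>s. bc_integral D (\<lambda>t. F r s t)) =
      ?K * ((C * Z) ^ r / bc_Gamma (V + M + of_nat r + 1))" for r
    unfolding J bc_integral_eqI[OF outer] by (rule bicomplex_eqI) simp_all
  then have sums: "(\<lambda>r. (C * Z) ^ r / fact r *
      bc_integral A (\<lambda>s. bc_integral D (\<lambda>t. F r s t))) sums (?K * S)"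
    using S[of ?K] by simp
  have "miller_ross (V + M) C Z = Z bpowr (V + M) * S"
    using S[of 1] by (simp add: miller_ross_def sums_iff)
  also have "\<dots> = Z bpowr (V + M) / ?K * (?K * S)"
    using nz by (intro bicomplex_eqI) simp_all
  finally show ?thesis
    using inner outer sums J by (auto simp: bc_integrable_on_def sums_iff)
qed

end
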